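(* Consider a six-dimensional chiral two-form theory in the PST formulation with interaction function $\mathcal H(s,p)$ satisfying $$\mathcal H_s^2+\frac{2s}{p}\,\mathcal H_s\mathcal H_p+\mathcal H_p^2=1 .$$ Given any two invariant observables $\mathcal O_1(s,p)$ and $\mathcal O_2(s,p)$ of this theory, that is, two functions each satisfying $$\mathcal H_s\mathcal O_s+\frac sp\left(\mathcal H_p\mathcal O_s+\mathcal H_s\mathcal O_p\right)+\mathcal H_p\mathcal O_p=0 ,$$ there exists a functional relation of the form $$\Upsilon(\mathcal O_1,\mathcal O_2)=0 ,$$ that is, $\mathcal O_1$ and $\mathcal O_2$ are functionally dependent. Thus, away from exceptional points, one can locally invert to express one of the two observables in terms of the other.
   Context: Subscripts $s,p$ denote partial derivatives. Let $A_{\mu\nu}$ be a two-form gauge field in six space-time dimensions (mostly plus metric) with field strength $F_{\mu\nu\rho}=3\partial_{[\mu}A_{\nu\rho]}$, Hodge dual $F^*$, and let $v_\mu$ be the unit timelike vector $v_\mu=\partial_\mu a/\sqrt{-\partial_\nu a\,\partial^\nu a}$ built from an auxiliary scalar $a(x)$. Set $E_{\mu\nu}=F_{\mu\nu\rho}v^\rho$ and $B_{\mu\nu}=F^*_{\mu\nu\rho}v^\rho$. The PST Lagrangian density is $\sqrt{-g}\left(\frac14E^{\mu\nu}B_{\mu\nu}-\mathcal H(s,p)\right)$, with $s=\frac14B_{\mu\nu}B^{\mu\nu}$, $p=\sqrt{p_\mu p^\mu}$, $p^\mu=-\frac1{8\sqrt{-g}}\varepsilon^{\mu\nu\rho\lambda\sigma\kappa}B_{\rho\lambda}B_{\sigma\kappa}v_\nu$.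 The non-linear PDE on $\mathcal H$ is the condition of PST gauge invariance (equivalently, of Lorentz invariance of the theory with Hamiltonian density $\mathcal H$). The linear PDE on $\mathcal O$ says that $\mathcal H+\lambda\mathcal O$ satisfies the non-linear PDE to leading order in $\lambda$; it is equivalent to $\mathcal O$ being independent of $v_\mu$ on the mass shell. The relation is understood as non-trivial, and $\Upsilon$ denotes some function of two variables (depending on the theory and on the two observables). *)

theory Defs
  imports "HOL-Analysis.Analysis"
begin

text \<open>
  A point of \<^typ>\<open>real \<times> real\<close> is a pair \<open>(s, p)\<close> of values of the two invariants (and, for the
  relation \<open>\<Upsilon>\<close> below, a pair of values of the two observables).
\<close>

definition partial1 :: "(real \<times> real \<Rightarrow> real) \<Rightarrow> real \<times> real \<Rightarrow> real" where
  "partial1 f x = deriv (\<lambda>t. f (t, snd x)) (fst x)"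

definition partial2 :: "(real \<times> real \<Rightarrow> real) \<Rightarrow> real \<times> real \<Rightarrow> real" where
  "partial2 f x = deriv (\<lambda>t. f (fst x, t)) (snd x)"

text \<open>Only used for open \<open>U\<close>.\<close>

definition C1_on :: "(real \<times> real) set \<Rightarrow> (real \<times> real \<Rightarrow> real) \<Rightarrow> bool" where
  "C1_on U f \<longleftrightarrow>
     (\<forall>x\<in>U. f differentiable at x) \<and> continuous_on U (partial1 f) \<and> continuous_on U (partial2 f)"

text \<open>The condition of PST gauge invariance on the interaction function \<open>H(s, p)\<close>.\<close>

definition PST_invariant :: "(real \<times> real) set \<Rightarrow> (real \<times> real \<Rightarrow> real) \<Rightarrow> bool" where
  "PST_invariant U H \<longleftrightarrow>
     (\<forall>(s, p)\<in>U.
        (partial1 H (s, p))\<^sup>2 + 2 * s / p * partial1 H (s, p) * partial2 H (s, p)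
          + (partial2 H (s, p))\<^sup>2 = 1)"

definition invariant_observable ::
  "(real \<times> real) set \<Rightarrow> (real \<times> real \<Rightarrow> real) \<Rightarrow> (real \<times> real \<Rightarrow> real) \<Rightarrow> bool" where
  "invariant_observable U H Ob \<longleftrightarrow>
     (\<forall>(s, p)\<in>U.
        partial1 H (s, p) * partial1 Ob (s, p)
          + s / p * (partial2 H (s, p) * partial1 Ob (s, p) + partial1 H (s, p) * partial2 Ob (s, p))
          + partial2 H (s, p) * partial2 Ob (s, p) = 0)"

text \<open>
  \<open>\<Upsilon>(f, g) = 0\<close> on \<open>S\<close>. Non-triviality of \<open>\<Upsilon>\<close> means that its zero set is Lebesgue null; in
  particular \<open>\<Upsilon>\<close> does not vanish identically on any nonempty open set.
\<close>

definition nontrivial_relation_on ::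
  "(real \<times> real) set \<Rightarrow> (real \<times> real \<Rightarrow> real) \<Rightarrow> (real \<times> real \<Rightarrow> real) \<Rightarrow> (real \<times> real \<Rightarrow> real) \<Rightarrow> bool"
where
  "nontrivial_relation_on S f g \<Upsilon> \<longleftrightarrow>
     (\<forall>x\<in>S. \<Upsilon> (f x, g x) = 0) \<and> negligible {z. \<Upsilon> z = 0}"

text \<open>
  Functional dependence in the classical sense, with a continuously differentiable relation over each
  compact subset of the domain. Over all of \<open>U\<close> a non-trivial continuous relation need not exist: for
  \<open>H = s\<close> every function of \<open>s\<^sup>2 - p\<^sup>2\<close> is an invariant observable, and the curve traced out by two
  such functions may be dense in the plane.
\<close>

definition functionally_dependent_on ::
  "(real \<times> real) set \<Rightarrow> (real \<times> real \<Rightarrow> real) \<Rightarrow> (real \<times> real \<Rightarrow> real) \<Rightarrow> bool" where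
  "functionally_dependent_on U f g \<longleftrightarrow>
     (\<forall>K. compact K \<and> K \<subseteq> U \<longrightarrow> (\<exists>\<Upsilon>. C1_on UNIV \<Upsilon> \<and> nontrivial_relation_on K f g \<Upsilon>))"

text \<open>Near \<open>x\<close>, the function \<open>g\<close> is a continuously differentiable function of \<open>f\<close>.\<close>

definition locally_expressible ::
  "(real \<times> real) set \<Rightarrow> (real \<times> real \<Rightarrow> real) \<Rightarrow> (real \<times> real \<Rightarrow> real) \<Rightarrow> real \<times> real \<Rightarrow> bool" where
  "locally_expressible U f g x \<longleftrightarrow>
     (\<exists>V W \<phi>. open V \<and> x \<in> V \<and> V \<subseteq> U \<and> open W \<and> f ` V \<subseteq> W \<and>
        \<phi> C1_differentiable_on W \<and> (\<forall>y\<in>V. g y = \<phi> (f y)))"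

end

(*
  At every point a non-zero vector is orthogonal to the gradients of both observables, so their
  Jacobian vanishes. By Sard's theorem the image of the map (O1, O2) is then a null set; a Borel null
  superset, respectively a C1 function whose zero set is the (compact, null) image of a given compact
  set, provides the relation. Where one gradient does not vanish, the inverse function theorem
  expresses the other observable locally; on an open set where neither applies both observables are
  locally constant.
*)
theory Submission
  imports Defs
begin

section \<open>Gradients and total derivatives of C1 functions\<close>

definition gradient :: "(real \<times> real \<Rightarrow> real) \<Rightarrow> real \<times> real \<Rightarrow> real \<times> real" where
  "gradient f x = (partial1 f x, partial2 f x)"

text \<open>The chain rule along both coordinate lines through \<open>x\<close> yields genuine
  one-variable derivatives, so \<open>deriv\<close> returns the components of \<open>G\<close> and
  not an arbitrary value.\<close>

lemma gradient_eqI: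
  fixes f :: "real \<times> real \<Rightarrow> real"
  assumes "(f has_derivative (\<lambda>h. G \<bullet> h)) (at x)"
  shows "gradient f x = G"
proof -
  obtain s p where x: "x = (s, p)" by (cases x)
  have d: "(f has_derivative (\<lambda>h. G \<bullet> h)) (at (s, p))"
    using assms x by simp
  have "((\<lambda>t. f (t, p)) has_derivative (\<lambda>t. G \<bullet> (t, 0))) (at s)"
    by (rule has_derivative_compose[where f = "\<lambda>t. (t, p)" and g = f, OF _ d])
      (auto intro!: derivative_eq_intros)
  then have 1: "DERIV (\<lambda>t. f (t, p)) s :> fst G"
    by (simp add: has_field_derivative_def inner_prod_def)
  have "((\<lambda>t. f (s, t)) has_derivative (\<lambda>t. G \<bullet> (0, t))) (at p)"
    by (rule has_derivative_compose[where f = "\<lambda>t. (s, t)" and g = f, OF _ d])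
      (auto intro!: derivative_eq_intros)
  then have 2: "DERIV (\<lambda>t. f (s, t)) p :> snd G"
    by (simp add: has_field_derivative_def inner_prod_def)
  show ?thesis
    using 1 2 by (simp add: gradient_def partial1_def partial2_def x DERIV_imp_deriv)
qed

text \<open>A linear functional on the plane is the inner product with the vector of its values on
  the two unit vectors.\<close>

lemma C1_on_has_derivative:
  assumes "C1_on U f" "x \<in> U"
  shows "(f has_derivative (\<lambda>h. gradient f x \<bullet> h)) (at x)"
proof -
  have "f differentiable at x"
    using assms by (auto simp: C1_on_def)
  then obtain D where D: "(f has_derivative D) (at x)"
    by (auto simp: differentiable_def)
  then have lin: "linear D"
    using has_derivative_linear by blast
  have D_eq: "D = (\<lambda>h. (D (1, 0), D (0, 1)) \<bullet> h)"
  proof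
    fix h :: "real \<times> real"
    have "D h = D (fst h *\<^sub>R (1, 0) + snd h *\<^sub>R (0, 1))"
      by simp
    also have "\<dots> = fst h * D (1, 0) + snd h * D (0, 1)"
      unfolding linear_add[OF lin] linear_scale[OF lin] by simp
    finally show "D h = (D (1, 0), D (0, 1)) \<bullet> h"
      by (simp add: inner_prod_def mult.commute)
  qed
  show ?thesis
    using D gradient_eqI D_eq by metis
qed

lemma C1_on_continuous_gradient: "C1_on U f \<Longrightarrow> continuous_on U (gradient f)"
  unfolding C1_on_def gradient_def [abs_def] by (intro continuous_on_Pair) auto

lemma C1_on_imp_continuous_on:
  assumes "C1_on U f"
  shows "continuous_on U f"
  using C1_on_has_derivative[OF assms] continuous_at_imp_continuous_on has_derivative_continuous
  by blast

lemma C1_onI: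
  assumes "\<And>x. x \<in> U \<Longrightarrow> (f has_derivative (\<lambda>h. G x \<bullet> h)) (at x)" "continuous_on U G"
  shows "C1_on U f"
proof -
  have G: "G x = (partial1 f x, partial2 f x)" if "x \<in> U" for x
    using gradient_eqI[OF assms(1)[OF that]] by (simp add: gradient_def)
  have "continuous_on U (\<lambda>x. fst (G x))" "continuous_on U (\<lambda>x. snd (G x))"
    using assms(2) by (auto intro!: continuous_intros)
  then have "continuous_on U (partial1 f)" "continuous_on U (partial2 f)"
    by (auto simp: G cong: continuous_on_cong)
  then show ?thesis
    using assms(1) by (auto simp: C1_on_def differentiable_def)
qed

section \<open>Vanishing Jacobian of two observables\<close>

definition jacobian ::
  "(real \<times> real \<Rightarrow> real) \<Rightarrow> (real \<times> real \<Rightarrow> real) \<Rightarrow> real \<times> real \<Rightarrow> real" where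
  "jacobian f g x = partial1 f x * partial2 g x - partial2 f x * partial1 g x"

lemma jacobian_swap: "jacobian g f x = - jacobian f g x"
  by (simp add: jacobian_def)

text \<open>
  Both observables are annihilated by the vector field with components
  \<open>H\<^sub>s + (s/p) H\<^sub>p\<close> and \<open>(s/p) H\<^sub>s + H\<^sub>p\<close>; pairing it with the gradient of \<open>H\<close> gives the left-hand
  side of the non-linear equation, so it vanishes nowhere.
\<close>

lemma jacobian_observables_eq_0:
  assumes "PST_invariant U H" "invariant_observable U H f" "invariant_observable U H g" "x \<in> U"
  shows "jacobian f g x = 0"
proof -
  obtain s p where x: "x = (s, p)" by (cases x)
  define a where "a = partial1 H x + s / p * partial2 H x"
  define b where "b = s / p * partial1 H x + partial2 H x"
  have ab: "partial1 H x * a + partial2 H x * b = 1"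
    using assms(1,4) unfolding PST_invariant_def a_def b_def x
    by (auto simp: algebra_simps power2_eq_square)
  have f: "a * partial1 f x + b * partial2 f x = 0"
    using assms(2,4) unfolding invariant_observable_def a_def b_def x
    by (auto simp: algebra_simps)
  have g: "a * partial1 g x + b * partial2 g x = 0"
    using assms(3,4) unfolding invariant_observable_def a_def b_def x
    by (auto simp: algebra_simps)
  \<comment> \<open>The vector \<open>(a, b)\<close> is in the kernel of the matrix of gradients, so
    Cramer's rule kills both multiples of its determinant; \<open>ab\<close> combines them into the
    determinant itself.\<close>
  have "a * jacobian f g x = 0" "b * jacobian f g x = 0"
    using f g unfolding jacobian_def by algebra+
  then show ?thesis
    using ab by auto
qed

section \<open>Sard's theorem for the pair of observables\<close>

text \<open>Every point of \<open>U\<close> is critical, so the whole image consists of critical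
  values. \<open>baby_Sard\<close> is stated for \<open>real^'n\<close>, hence the transport along
  \<open>T\<close>.\<close>

lemma negligible_image_jacobian_eq_0:
  assumes f: "C1_on U f" and g: "C1_on U g" and J: "\<And>x. x \<in> U \<Longrightarrow> jacobian f g x = 0"
  shows "negligible ((\<lambda>x. (f x, g x)) ` U)"
proof -
  define T :: "real^2 \<Rightarrow> real \<times> real" where "T v = (v $ 1, v $ 2)" for v
  define S where "S = T -` U"
  define F :: "real^2 \<Rightarrow> real^2" where "F v = vector [f (T v), g (T v)]" for v
  define F' :: "real^2 \<Rightarrow> real^2 \<Rightarrow> real^2"
    where "F' v h = vector [gradient f (T v) \<bullet> T h, gradient g (T v) \<bullet> T h]" for v h
  have T_vec: "T (vector [a, b]) = (a, b)" for a b
    by (simp add: T_def)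
  have blT: "bounded_linear T"
    unfolding T_def by (intro bounded_linear_Pair bounded_linear_vec_nth)
  have vec_eq: "vector [a, b] = a *\<^sub>R axis 1 1 + b *\<^sub>R (axis 2 1 :: real^2)" for a b
    by (simp add: vec_eq_iff forall_2 axis_def)
  have der: "(F has_derivative F' v) (at v within S)" if "v \<in> S" for v
  proof -
    have "T v \<in> U" using that by (simp add: S_def)
    have dT: "(T has_derivative T) (at v within S)"
      using blT by (rule bounded_linear_imp_has_derivative)
    have "((\<lambda>w. f (T w)) has_derivative (\<lambda>h. gradient f (T v) \<bullet> T h)) (at v within S)"
      "((\<lambda>w. g (T w)) has_derivative (\<lambda>h. gradient g (T v) \<bullet> T h)) (at v within S)"
      using has_derivative_compose[OF dT C1_on_has_derivative[OF f \<open>T v \<in> U\<close>]]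
        has_derivative_compose[OF dT C1_on_has_derivative[OF g \<open>T v \<in> U\<close>]] by auto
    then show ?thesis
      unfolding F_def [abs_def] F'_def [abs_def] vec_eq
      by (intro has_derivative_add has_derivative_scaleR_left)
  qed
  have rank: "rank (matrix (F' v)) < CARD(2)" if "v \<in> S" for v
  proof -
    have lin: "linear (F' v)"
      using der[OF that] has_derivative_linear by blast
    have Tv: "jacobian f g (T v) = 0"
      using J that by (auto simp: S_def)
    have "\<not> inj (F' v)"
    proof -
      \<comment> \<open>The gradient of \<open>f\<close> turned by a right angle pairs to 0 with
        that of \<open>f\<close> and to the Jacobian with that of \<open>g\<close>. If it is zero,
        the turned gradient of \<open>g\<close> serves; if both vanish, any nonzero vector.\<close>
      have ker: "\<exists>a b. (a, b) \<noteq> (0, 0) \<and> F' v (vector [a, b]) = 0"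
      proof (cases "gradient f (T v) = 0")
        case False
        then show ?thesis
          using Tv
          by (intro exI[of _ "- partial2 f (T v)"] exI[of _ "partial1 f (T v)"])
            (auto simp: F'_def T_vec jacobian_def gradient_def vec_eq_iff forall_2 zero_prod_def
              algebra_simps)
      next
        case f0: True
        show ?thesis
        proof (cases "gradient g (T v) = 0")
          case False
          then show ?thesis
            using f0
            by (intro exI[of _ "- partial2 g (T v)"] exI[of _ "partial1 g (T v)"])
              (auto simp: F'_def T_vec gradient_def vec_eq_iff forall_2 zero_prod_def algebra_simps)
        next
          case True
          then show ?thesis
            using f0 by (intro exI[of _ 1]) (auto simp: F'_def vec_eq_iff forall_2)
        qed
      qed
      then obtain a b where ab: "(a, b) \<noteq> (0, 0)" "F' v (vector [a, b]) = 0"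
        by blast
      have "vector [a, b] \<noteq> (0 :: real^2)"
        using ab(1) by (auto simp: vec_eq_iff forall_2)
      then show ?thesis
        using ab(2) lin linear_injective_0 by blast
    qed
    then show ?thesis
      using less_rank_noninjective[of "matrix (F' v)"] lin by simp
  qed
  have "negligible (F ` S)"
    by (rule baby_Sard[OF order_refl der rank])
  then have "negligible (T ` F ` S)"
    by (rule negligible_differentiable_image_negligible[rotated])
      (auto intro!: differentiable_at_imp_differentiable_on bounded_linear_imp_differentiable blT)
  moreover have "T ` F ` S = (\<lambda>x. (f x, g x)) ` U"
  proof -
    have "T (F v) = (f (T v), g (T v))" for v
      by (simp add: F_def T_vec)
    moreover have "T ` S = U"
      using T_vec by (auto simp: S_def image_iff) (metis surj_pair vimageI)
    ultimately show ?thesis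
      by (auto simp: image_image)
  qed
  ultimately show ?thesis
    by simp
qed

section \<open>C1 functions with a prescribed closed zero set\<close>

text \<open>
  The balls with centres \<open>d\<^sub>n\<close> in a countable dense set and radii \<open>min 1 (infdist d\<^sub>n C)\<close> cover exactly
  the complement of \<open>C\<close>; sum geometrically weighted bumps supported on them.
\<close>

lemma closed_is_C1_zero_set:
  fixes C :: "(real \<times> real) set"
  assumes "closed C"
  obtains \<Upsilon> where "C1_on UNIV \<Upsilon>" "{z. \<Upsilon> z = 0} = C"
proof (cases "C = {}")
  case True
  \<comment> \<open>\<open>infdist\<close> to the empty set is 0 by convention, so the bumps below
    would all vanish; a constant serves instead.\<close>
  have "C1_on UNIV (\<lambda>_. 1)"
    by (rule C1_onI[where G = "\<lambda>_. 0"]) auto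
  then show ?thesis
    using that[of "\<lambda>_. 1"] True by auto
next
  case False
  obtain D :: "(real \<times> real) set" where D: "countable D"
    "\<And>X. open X \<Longrightarrow> X \<noteq> {} \<Longrightarrow> \<exists>d\<in>D. d \<in> X"
    using countable_dense_exists by metis
  have "D \<noteq> {}"
    using D(2)[of UNIV] by auto
  define d where "d = from_nat_into D"
  have d_dense: "\<exists>n. d n \<in> X" if "open X" "X \<noteq> {}" for X
    using D(2)[OF that] from_nat_into_surj[OF D(1)] unfolding d_def by metis
  \<comment> \<open>The distance keeps each open ball off \<open>C\<close>; the cap 1 allows bounds
    uniform in \<open>n\<close>.\<close>
  define r where "r n = min 1 (infdist (d n) C)" for n
  have r: "0 \<le> r n" "r n \<le> 1" for n
    by (auto simp: r_def infdist_nonneg)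
  \<comment> \<open>The squared distance is smooth at the centre, and squaring \<open>q\<close> in
    \<open>f\<close> removes the kink on the boundary circle. \<open>G n\<close> is the gradient of
    \<open>f n\<close>.\<close>
  define q where "q n z = max 0 ((r n)\<^sup>2 - (z - d n) \<bullet> (z - d n))" for n z
  define f where "f n z = (1/2)^n * (q n z)\<^sup>2" for n z
  define G where "G n z = (- 4 * (1/2)^n * q n z) *\<^sub>R (z - d n)" for n z
  have q: "0 \<le> q n z" "q n z \<le> 1" for n z
  proof -
    have "(r n)\<^sup>2 \<le> 1" using r[of n] by (simp add: power_le_one)
    then show "q n z \<le> 1" unfolding q_def using inner_ge_zero[of "z - d n"] by linarith
  qed (simp add: q_def)
  have q_pos: "0 < q n z \<longleftrightarrow> dist z (d n) < r n" for n z
  proof -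
    have "0 < q n z \<longleftrightarrow> (norm (z - d n))\<^sup>2 < (r n)\<^sup>2"
      by (auto simp: q_def power2_norm_eq_inner)
    also have "\<dots> \<longleftrightarrow> dist z (d n) < r n"
      using r(1)[of n] unfolding dist_norm
      by (metis norm_ge_zero power2_less_imp_less power_strict_mono zero_less_numeral)
    finally show ?thesis .
  qed
  have sq: "((\<lambda>t::real. (max 0 t)\<^sup>2) has_field_derivative 2 * max 0 t) (at t)" for t
  proof -
    consider "t > 0" | "t < 0" | "t = 0" by linarith
    then show ?thesis
    proof cases
      case 1
      have "((\<lambda>t::real. t\<^sup>2) has_field_derivative 2 * t) (at t)"
        by (auto intro!: derivative_eq_intros)
      then have "((\<lambda>t::real. (max 0 t)\<^sup>2) has_field_derivative 2 * t) (at t)"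
        by (rule has_field_derivative_transform_within_open[of _ _ _ "{0<..}"]) (use 1 in auto)
      then show ?thesis using 1 by simp
    next
      case 2
      have "((\<lambda>t::real. 0) has_field_derivative 0) (at t)"
        by simp
      then have "((\<lambda>t::real. (max 0 t)\<^sup>2) has_field_derivative 0) (at t)"
        by (rule has_field_derivative_transform_within_open[of _ _ _ "{..<0}"]) (use 2 in auto)
      then show ?thesis using 2 by simp
    next
      case 3
      \<comment> \<open>At the kink the difference quotient is \<open>max 0 h\<close>, which tends
        to 0.\<close>
      have "((\<lambda>h::real. max 0 h) \<longlongrightarrow> max 0 0) (at 0)"
        by (intro tendsto_intros)
      moreover have "\<forall>\<^sub>F h in at 0. max 0 h = ((max 0 h)\<^sup>2 - 0) / (h :: real)"
        by (auto simp: eventually_at_filter max_def power2_eq_square)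
      ultimately have "((\<lambda>h::real. ((max 0 h)\<^sup>2 - 0) / h) \<longlongrightarrow> 0) (at 0)"
        using Lim_transform_eventually by fastforce
      then show ?thesis using 3 by (simp add: DERIV_def)
    qed
  qed
  have der: "(f n has_derivative (\<lambda>h. G n z \<bullet> h)) (at z)" for n z
  proof -
    have 1: "((\<lambda>z. (r n)\<^sup>2 - (z - d n) \<bullet> (z - d n)) has_derivative (\<lambda>h. - 2 * ((z - d n) \<bullet> h))) (at z)"
      by (auto intro!: derivative_eq_intros simp: inner_commute)
    have "((\<lambda>z. (q n z)\<^sup>2) has_derivative (\<lambda>h. 2 * q n z * (- 2 * ((z - d n) \<bullet> h)))) (at z)"
      using has_derivative_compose[OF 1 sq[unfolded has_field_derivative_def]]
      by (simp add: q_def)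
    then have "(f n has_derivative (\<lambda>h. (1/2)^n * (2 * q n z * (- 2 * ((z - d n) \<bullet> h))))) (at z)"
      unfolding f_def [abs_def] by (rule has_derivative_mult_right)
    then show ?thesis
      by (simp add: G_def algebra_simps)
  qed
  have norm_G: "norm (G n z) \<le> 4 * (1/2)^n" for n z
  proof (cases "q n z = 0")
    case False
    then have "norm (z - d n) \<le> 1"
      using q_pos[of n z] q[of n z] r[of n] by (auto simp: dist_norm)
    then have "q n z * norm (z - d n) \<le> 1 * 1"
      using q[of n z] by (intro mult_mono) auto
    then show ?thesis
      using q[of n z] by (simp add: G_def abs_mult)
  qed (simp add: G_def)
  have cont_G: "continuous_on UNIV (G n)" for n
    unfolding G_def [abs_def] q_def by (intro continuous_intros)
  have summ: "summable (\<lambda>n. 4 * (1/2)^n :: real)"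
    by (intro summable_mult summable_geometric) auto
  define g where "g z = (\<Sum>n. G n z)" for z
  \<comment> \<open>The M-test for the gradients gives continuity of their sum and permits termwise
    differentiation.\<close>
  have unif: "uniform_limit UNIV (\<lambda>n z. \<Sum>i<n. G i z) g sequentially"
    unfolding g_def [abs_def] by (rule Weierstrass_m_test[OF _ summ]) (use norm_G in auto)
  have cont_g: "continuous_on UNIV g"
    by (rule uniform_limit_theorem[OF _ unif])
      (auto intro!: always_eventually continuous_on_sum cont_G)
  have f_nonneg: "0 \<le> f n z" for n z
    by (simp add: f_def)
  have f_le: "f n z \<le> (1/2)^n" for n z
    using q[of n z] by (simp add: f_def power_le_one)
  have f_summable: "summable (\<lambda>n. f n z)" for z
    by (rule summable_comparison_test'[of "\<lambda>n. (1/2)^n"])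
      (use f_nonneg f_le in \<open>auto intro: summable_geometric\<close>)
  \<comment> \<open>Cauchy-Schwarz turns \<open>unif\<close> into uniform convergence of the
    derivatives as linear maps; convergence of the values is needed at one point only, here
    0.\<close>
  have "\<exists>\<Upsilon>. \<forall>z\<in>UNIV. (\<lambda>n. f n z) sums \<Upsilon> z \<and> (\<Upsilon> has_derivative (\<lambda>h. g z \<bullet> h)) (at z within UNIV)"
  proof (rule has_derivative_series)
    show "\<forall>\<^sub>F n in sequentially. \<forall>z\<in>UNIV. \<forall>h. norm ((\<Sum>i<n. G i z \<bullet> h) - g z \<bullet> h) \<le> e * norm h"
      if "e > 0" for e
      using uniform_limitD[OF unif that]
    proof eventually_elim
      case (elim n)
      show ?case
      proof (intro ballI allI)
        fix z h
        have "norm ((\<Sum>i<n. G i z \<bullet> h) - g z \<bullet> h) = norm (((\<Sum>i<n. G i z) - g z) \<bullet> h)"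
          by (simp add: inner_diff_left inner_sum_left)
        also have "\<dots> \<le> norm ((\<Sum>i<n. G i z) - g z) * norm h"
          using Cauchy_Schwarz_ineq2 by auto
        also have "\<dots> \<le> e * norm h"
          using elim[rule_format, of z] by (intro mult_right_mono) (simp_all add: dist_norm)
        finally show "norm ((\<Sum>i<n. G i z \<bullet> h) - g z \<bullet> h) \<le> e * norm h" .
      qed
    qed
    show "(\<lambda>n. f n 0) sums (\<Sum>n. f n 0)"
      using f_summable by (rule summable_sums)
  qed (use der in auto)
  then obtain \<Upsilon> where \<Upsilon>: "\<And>z. (\<lambda>n. f n z) sums \<Upsilon> z"
    "\<And>z. (\<Upsilon> has_derivative (\<lambda>h. g z \<bullet> h)) (at z)"
    by auto
  have "\<Upsilon> z = 0 \<longleftrightarrow> z \<in> C" for z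
  proof -
    have "\<Upsilon> z = 0 \<longleftrightarrow> (\<forall>n. f n z = 0)"
      using suminf_eq_zero_iff[OF f_summable f_nonneg, of z] sums_unique[OF \<Upsilon>(1), of z] by simp
    also have "\<dots> \<longleftrightarrow> (\<forall>n. \<not> dist z (d n) < r n)"
    proof -
      have "f n z = 0 \<longleftrightarrow> \<not> 0 < q n z" for n
        using q(1)[of n z] by (auto simp: f_def)
      then show ?thesis
        by (simp add: q_pos)
    qed
    also have "\<dots> \<longleftrightarrow> z \<in> C"
    proof
      assume "z \<in> C"
      then have "r n \<le> dist z (d n)" for n
        using infdist_le[of z C "d n"] by (auto simp: r_def dist_commute)
      then show "\<forall>n. \<not> dist z (d n) < r n"
        by (auto simp: not_less)
    next
      assume *: "\<forall>n. \<not> dist z (d n) < r n"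
      show "z \<in> C"
      proof (rule ccontr)
        assume "z \<notin> C"
        then have pos: "0 < infdist z C"
          using False assms infdist_pos_not_in_closed by blast
        \<comment> \<open>Within half the distance, \<open>d n\<close> is farther from
          \<open>C\<close> than from \<open>z\<close>; the bound 1 respects the cap in
          \<open>r\<close>.\<close>
        obtain n where n: "d n \<in> ball z (min 1 (infdist z C / 2))"
          using d_dense[of "ball z (min 1 (infdist z C / 2))"] pos by fastforce
        have "infdist z C \<le> infdist (d n) C + dist z (d n)"
          by (rule infdist_triangle)
        then have "dist z (d n) < r n"
          using n by (auto simp: r_def)
        then show False
          using * by blast
      qed
    qed
    finally show ?thesis .
  qed
  then show ?thesis
    using that[of \<Upsilon>] C1_onI[OF \<Upsilon>(2) cont_g] by auto
qed

section \<open>Local inversion where a gradient does not vanish\<close>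

text \<open>
  Adding to \<open>f\<close> a linear coordinate that is constant along the gradient of \<open>f\<close> at \<open>x\<close> gives local
  coordinates \<open>\<Phi>\<close>. In these coordinates the vanishing Jacobian says that \<open>g\<close> does not depend on the
  second one.
\<close>

lemma locally_expressible_if_gradient_neq_0:
  assumes U: "open U" and f: "C1_on U f" and g: "C1_on U g"
    and J: "\<And>x. x \<in> U \<Longrightarrow> jacobian f g x = 0"
    and x: "x \<in> U" and grad: "gradient f x \<noteq> 0"
  shows "locally_expressible U f g x"
proof -
  define a0 b0 where "a0 = partial1 f x" and "b0 = partial2 f x"
  \<comment> \<open>The second coordinate has gradient \<open>(- b0, a0)\<close>, that of
    \<open>f\<close> at \<open>x\<close> turned by a right angle, so the determinant at
    \<open>x\<close> is \<open>a0\<^sup>2 + b0\<^sup>2\<close>.\<close>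
  define \<Phi> where "\<Phi> y = (f y, a0 * snd y - b0 * fst y)" for y
  \<comment> \<open>The inverse function theorem wants a continuous family of \<open>blinfun\<close>
    derivatives; with fixed \<open>L1\<close>, \<open>L2\<close>, \<open>L3\<close> this reduces to
    continuity of the partial derivatives.\<close>
  define L1 L2 L3 :: "(real \<times> real) \<Rightarrow>\<^sub>L (real \<times> real)"
    where "L1 = Blinfun (\<lambda>h. (fst h, 0))" and "L2 = Blinfun (\<lambda>h. (snd h, 0))"
      and "L3 = Blinfun (\<lambda>h. (0, a0 * snd h - b0 * fst h))"
  define \<Phi>' where "\<Phi>' y = partial1 f y *\<^sub>R L1 + partial2 f y *\<^sub>R L2 + L3" for y
  have L: "blinfun_apply L1 h = (fst h, 0)" "blinfun_apply L2 h = (snd h, 0)"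
    "blinfun_apply L3 h = (0, a0 * snd h - b0 * fst h)" for h
    unfolding L1_def L2_def L3_def
    by (subst bounded_linear_Blinfun_apply; auto intro!: bounded_linear_intros)+
  have \<Phi>'_apply: "blinfun_apply (\<Phi>' y) h = (gradient f y \<bullet> h, a0 * snd h - b0 * fst h)" for y h
    by (simp add: \<Phi>'_def blinfun.bilinear_simps L gradient_def inner_prod_def)
  have der_\<Phi>: "(\<Phi> has_derivative blinfun_apply (\<Phi>' y)) (at y)" if "y \<in> U" for y
    unfolding \<Phi>_def [abs_def] \<Phi>'_apply [abs_def]
    by (intro has_derivative_Pair C1_on_has_derivative[OF f that])
      (auto intro!: derivative_eq_intros)
  have cont_\<Phi>': "continuous_on U \<Phi>'"
    using f unfolding \<Phi>'_def [abs_def] C1_on_def by (auto intro!: continuous_intros)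
  define R where "R = a0\<^sup>2 + b0\<^sup>2"
  have R: "R \<noteq> 0"
    using grad by (simp add: R_def a0_def b0_def gradient_def zero_prod_def sum_power2_eq_zero_iff)
  \<comment> \<open>The inverse of the matrix with rows \<open>(a0, b0)\<close> and
    \<open>(- b0, a0)\<close>.\<close>
  define inv0 :: "(real \<times> real) \<Rightarrow>\<^sub>L (real \<times> real)"
    where "inv0 = Blinfun (\<lambda>h. (1 / R) *\<^sub>R (a0 * fst h - b0 * snd h, b0 * fst h + a0 * snd h))"
  have inv0: "blinfun_apply inv0 h
      = (1 / R) *\<^sub>R (a0 * fst h - b0 * snd h, b0 * fst h + a0 * snd h)" for h
    unfolding inv0_def
    by (subst bounded_linear_Blinfun_apply)
      (auto simp flip: linear_conv_bounded_linear intro!: linearI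
        simp: algebra_simps add_divide_distrib diff_divide_distrib)
  have "inv0 o\<^sub>L \<Phi>' x = id_blinfun"
  proof (rule blinfun_eqI)
    fix h
    show "blinfun_apply (inv0 o\<^sub>L \<Phi>' x) h = blinfun_apply id_blinfun h"
      using R
      by (simp add: inv0 \<Phi>'_apply prod_eq_iff gradient_def inner_prod_def divide_simps
          flip: a0_def b0_def)
        (simp add: R_def algebra_simps power2_eq_square)
  qed
  from inverse_function_theorem[OF U der_\<Phi> cont_\<Phi>' x this]
  obtain U' V k k' where U': "open U'" "U' \<subseteq> U" "x \<in> U'" and V: "open V" "\<Phi> x \<in> V"
    and hom: "homeomorphism U' V \<Phi> k"
    and k: "\<And>z. z \<in> V \<Longrightarrow> (k has_derivative k' z) (at z)"
    and k': "\<And>z. z \<in> V \<Longrightarrow> k' z = inv (blinfun_apply (\<Phi>' (k z)))"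
    and bij: "\<And>z. z \<in> V \<Longrightarrow> bij (blinfun_apply (\<Phi>' (k z)))"
    by metis
  \<comment> \<open>This is the determinant of \<open>\<Phi>' y\<close>; were it 0,
    \<open>(a0, b0)\<close> would be in the kernel.\<close>
  define \<Delta> where "\<Delta> y = gradient f y \<bullet> (a0, b0)" for y
  have kU: "k z \<in> U" if "z \<in> V" for z
    using hom U'(2) that by (auto simp: homeomorphism_def)
  have \<Delta>: "\<Delta> (k z) \<noteq> 0" if "z \<in> V" for z
  proof
    assume "\<Delta> (k z) = 0"
    then have "blinfun_apply (\<Phi>' (k z)) (a0, b0) = blinfun_apply (\<Phi>' (k z)) 0"
      by (simp add: \<Phi>'_apply \<Delta>_def flip: zero_prod_def)
    then have "(a0, b0) = 0"
      using bij[OF that] by (meson bij_is_inj injD)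
    then show False
      using R by (simp add: R_def zero_prod_def)
  qed
  have k'_eqI: "k' z w = h" if "z \<in> V" "blinfun_apply (\<Phi>' (k z)) h = w" for z w h
    unfolding k'[OF that(1)] using bij[OF that(1)] that(2) by (metis bij_is_inj inv_f_f)
  \<comment> \<open>The columns of the inverse derivative: adjugate matrix over the
    determinant.\<close>
  have k'_1: "k' z (1, 0) = (1 / \<Delta> (k z)) *\<^sub>R (a0, b0)" if "z \<in> V" for z
  proof (rule k'_eqI[OF that])
    have "blinfun_apply (\<Phi>' (k z)) (a0, b0) = (\<Delta> (k z), 0)"
      by (simp add: \<Phi>'_apply \<Delta>_def)
    then show "blinfun_apply (\<Phi>' (k z)) ((1 / \<Delta> (k z)) *\<^sub>R (a0, b0)) = (1, 0)"
      using \<Delta>[OF that] unfolding blinfun.scaleR_right by simp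
  qed
  have k'_2: "k' z (0, 1) = (1 / \<Delta> (k z)) *\<^sub>R (- partial2 f (k z), partial1 f (k z))"
    if "z \<in> V" for z
  proof (rule k'_eqI[OF that])
    have "blinfun_apply (\<Phi>' (k z)) (- partial2 f (k z), partial1 f (k z)) = (0, \<Delta> (k z))"
      by (simp add: \<Phi>'_apply \<Delta>_def inner_prod_def gradient_def mult.commute)
    then show "blinfun_apply (\<Phi>' (k z))
        ((1 / \<Delta> (k z)) *\<^sub>R (- partial2 f (k z), partial1 f (k z))) = (0, 1)"
      using \<Delta>[OF that] unfolding blinfun.scaleR_right by simp
  qed
  have der_gk: "((\<lambda>z. g (k z)) has_derivative (\<lambda>h. gradient g (k z) \<bullet> k' z h)) (at z)"
    if "z \<in> V" for z
    using has_derivative_compose[OF k[OF that] C1_on_has_derivative[OF g kU[OF that]]] .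
  \<comment> \<open>Up to the factor \<open>1 / \<Delta> (k z)\<close>, this pairing is the Jacobian
    of \<open>f\<close> and \<open>g\<close>.\<close>
  have gk_2: "gradient g (k z) \<bullet> k' z (0, 1) = 0" if "z \<in> V" for z
  proof -
    have "gradient g (k z) \<bullet> (- partial2 f (k z), partial1 f (k z)) = 0"
      using J[OF kU[OF that]] by (simp add: gradient_def jacobian_def mult.commute)
    then show ?thesis
      by (simp only: k'_2[OF that] inner_scaleR_right mult_zero_right)
  qed
  \<comment> \<open>In a box whose second side is an interval, \<open>g\<close> composed with
    \<open>k\<close> is constant along each vertical segment, so it may be read off at height
    \<open>v0\<close>; this defines \<open>\<phi>\<close>.\<close>
  obtain A B where AB: "open A" "open B" "\<Phi> x \<in> A \<times> B" "A \<times> B \<subseteq> V"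
    using open_prod_elim[OF V] by metis
  obtain v0 where v0: "v0 = snd (\<Phi> x)" "v0 \<in> B"
    using AB(3) by (cases "\<Phi> x") auto
  obtain e where e: "e > 0" "ball v0 e \<subseteq> B"
    using AB(2) v0(2) open_contains_ball by blast
  define \<phi> where "\<phi> u = g (k (u, v0))" for u
  define \<phi>' where
    "\<phi>' u = (1 / \<Delta> (k (u, v0))) * (gradient g (k (u, v0)) \<bullet> (a0, b0))" for u
  have inV: "(u, v) \<in> V" if "u \<in> A" "v \<in> ball v0 e" for u v
    using AB(4) e(2) that by blast
  have inV0: "(u, v0) \<in> V" if "u \<in> A" for u
    using inV[OF that] e(1) by simp
  have \<phi>: "(\<phi> has_vector_derivative \<phi>' u) (at u)" if "u \<in> A" for u
  proof -
    have "((\<lambda>t. (t, v0)) has_derivative (\<lambda>t. (t, 0))) (at u)"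
      by (auto intro!: derivative_eq_intros)
    from has_derivative_compose[OF this der_gk[OF inV0[OF that]]]
    have d: "(\<phi> has_derivative (\<lambda>t. gradient g (k (u, v0)) \<bullet> k' (u, v0) (t, 0))) (at u)"
      by (simp add: \<phi>_def [abs_def])
    have lin: "linear (k' (u, v0))"
      using k[OF inV0[OF that]] has_derivative_linear by blast
    have "k' (u, v0) (t, 0) = t *\<^sub>R k' (u, v0) (1, 0)" for t
      using linear_scale[OF lin, of t "(1, 0)"] by simp
    then have "gradient g (k (u, v0)) \<bullet> k' (u, v0) (t, 0) = t *\<^sub>R \<phi>' u" for t
      by (simp only: k'_1[OF inV0[OF that]] inner_scaleR_right \<phi>'_def real_scaleR_def)
    then show ?thesis
      using d by (simp only: has_vector_derivative_def)
  qed
  have cont_k: "continuous_on A (\<lambda>u. k (u, v0))"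
    by (rule continuous_on_compose2[of V k])
      (use hom inV0 in \<open>auto simp: homeomorphism_def intro!: continuous_intros\<close>)
  have cont_grad: "continuous_on A (\<lambda>u. gradient f (k (u, v0)))"
    "continuous_on A (\<lambda>u. gradient g (k (u, v0)))"
    using C1_on_continuous_gradient[OF f] C1_on_continuous_gradient[OF g] kU inV0
    by (auto intro!: continuous_on_compose2[OF _ cont_k])
  have "continuous_on A \<phi>'"
    unfolding \<phi>'_def [abs_def] \<Delta>_def
    using cont_grad \<Delta>[OF inV0] by (intro continuous_intros) (auto simp: \<Delta>_def)
  then have "\<phi> C1_differentiable_on A"
    using \<phi> unfolding C1_differentiable_on_def by blast
  \<comment> \<open>The box pulled back to \<open>U'\<close>; the first coordinate of
    \<open>\<Phi> y\<close> is \<open>f y\<close>, so \<open>f\<close> maps \<open>X\<close> into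
    \<open>A\<close>.\<close>
  define X where "X = {y \<in> U'. \<Phi> y \<in> A \<times> ball v0 e}"
  have "continuous_on U' \<Phi>"
    using hom by (simp add: homeomorphism_def)
  then have "open X"
    unfolding X_def using continuous_open_preimage[of U' \<Phi> "A \<times> ball v0 e"] U'(1) AB(1)
    by (simp add: open_Times vimage_def Int_def)
  moreover have "x \<in> X"
    using U'(3) AB(3) v0(1) e(1) by (auto simp: X_def mem_Times_iff)
  moreover have "f ` X \<subseteq> A"
    by (auto simp: X_def \<Phi>_def)
  moreover have "g y = \<phi> (f y)" if "y \<in> X" for y
  proof -
    define u v where "u = fst (\<Phi> y)" and "v = snd (\<Phi> y)"
    have uv: "u \<in> A" "v \<in> ball v0 e"
      using that by (auto simp: X_def u_def v_def mem_Times_iff)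
    have "((\<lambda>t. g (k (u, t))) has_derivative (\<lambda>h. 0)) (at t within ball v0 e)"
      if t: "t \<in> ball v0 e" for t
    proof -
      have "((\<lambda>t. (u, t)) has_derivative (\<lambda>t. (0, t))) (at t within ball v0 e)"
        by (auto intro!: derivative_eq_intros)
      from has_derivative_compose[OF this der_gk[OF inV[OF uv(1) t]]]
      have d: "((\<lambda>t. g (k (u, t))) has_derivative
          (\<lambda>h. gradient g (k (u, t)) \<bullet> k' (u, t) (0, h))) (at t within ball v0 e)" .
      have lin: "linear (k' (u, t))"
        using k[OF inV[OF uv(1) t]] has_derivative_linear by blast
      have "gradient g (k (u, t)) \<bullet> k' (u, t) (0, h) = 0" for h
      proof -
        have "k' (u, t) (0, h) = h *\<^sub>R k' (u, t) (0, 1)"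
          using linear_scale[OF lin, of h "(0, 1)"] by simp
        then show ?thesis
          by (simp only: inner_scaleR_right gk_2[OF inV[OF uv(1) t]] mult_zero_right)
      qed
      then show ?thesis
        using d by (simp only:)
    qed
    then have "g (k (u, v)) = g (k (u, v0))"
      using e(1)
      by (intro has_derivative_zero_unique[OF convex_ball _ uv(2), of "\<lambda>t. g (k (u, t))"]) auto
    moreover have "k (u, v) = y"
      using hom that by (auto simp: homeomorphism_def X_def u_def v_def)
    ultimately show ?thesis
      by (simp add: \<phi>_def u_def \<Phi>_def)
  qed
  moreover have "X \<subseteq> U"
    using U'(2) by (auto simp: X_def)
  ultimately show ?thesis
    unfolding locally_expressible_def using AB(1) \<open>\<phi> C1_differentiable_on A\<close>
    by (intro exI[of _ X] exI[of _ A] exI[of _ \<phi>] conjI ballI)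
qed

section \<open>The exceptional set\<close>

text \<open>One neighbourhood \<open>V\<close> with its \<open>\<phi>\<close> serves every point of
  \<open>V\<close>.\<close>

lemma open_locally_expressible: "open {x. locally_expressible U f g x}"
proof (subst open_subopen, safe)
  fix x assume "locally_expressible U f g x"
  then obtain V where V: "open V" "x \<in> V"
    and "\<exists>W \<phi>. V \<subseteq> U \<and> open W \<and> f ` V \<subseteq> W \<and> \<phi> C1_differentiable_on W \<and>
      (\<forall>y\<in>V. g y = \<phi> (f y))"
    unfolding locally_expressible_def by metis
  then have "V \<subseteq> {x. locally_expressible U f g x}"
    unfolding locally_expressible_def by auto
  then show "\<exists>T. open T \<and> x \<in> T \<and> T \<subseteq> {x. locally_expressible U f g x}"
    using V by blast
qed

text \<open>Near \<open>x\<close> the function \<open>g\<close> is constant, so a constant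
  \<open>\<phi>\<close> works whatever \<open>f\<close> is.\<close>

lemma locally_expressible_if_gradient_eq_0:
  assumes T: "open T" "x \<in> T" "T \<subseteq> U" and g: "C1_on U g"
    and grad: "\<And>y. y \<in> T \<Longrightarrow> gradient g y = 0"
  shows "locally_expressible U f g x"
proof -
  obtain e where e: "e > 0" "ball x e \<subseteq> T"
    using T open_contains_ball by blast
  have "g y = g x" if "y \<in> ball x e" for y
  proof (rule has_derivative_zero_unique[of "ball x e" g])
    show "(g has_derivative (\<lambda>h. 0)) (at z within ball x e)" if "z \<in> ball x e" for z
    proof -
      have "z \<in> T" using that e(2) by blast
      then have "(g has_derivative (\<lambda>h. 0 \<bullet> h)) (at z)"
        using C1_on_has_derivative[OF g, of z] grad[of z] T(3) by auto
      then show ?thesis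
        by (simp add: has_derivative_at_withinI)
    qed
  qed (use that e(1) in auto)
  moreover have "ball x e \<subseteq> U" "x \<in> ball x e"
    using e T(3) by auto
  ultimately show ?thesis
    unfolding locally_expressible_def
    by (intro exI[of _ "ball x e"] exI[of _ UNIV] exI[of _ "\<lambda>_. g x"] conjI ballI
        open_ball open_UNIV C1_differentiable_on_const subset_UNIV)
qed

text \<open>Take for \<open>E\<close> the points where neither function is expressible by the other.
  On an open subset of \<open>E\<close> the gradient of \<open>g\<close> must vanish, as otherwise
  \<open>f\<close> is a function of \<open>g\<close>; but then \<open>g\<close> is locally constant,
  hence a function of \<open>f\<close>.\<close>

lemma closed_nowhere_dense_exceptional_set:
  assumes U: "open U" and f: "C1_on U f" and g: "C1_on U g"
    and J: "\<And>x. x \<in> U \<Longrightarrow> jacobian f g x = 0"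
  shows "\<exists>E \<subseteq> U. closedin (top_of_set U) E \<and> interior E = {} \<and>
    (\<forall>x\<in>U - E. locally_expressible U f g x \<or> locally_expressible U g f x)"
proof -
  define L where "L = {x. locally_expressible U f g x} \<union> {x. locally_expressible U g f x}"
  have "open L"
    unfolding L_def by (intro open_Un open_locally_expressible)
  have "closedin (top_of_set U) (U - L)"
    using \<open>open L\<close> by (metis Diff_eq closed_Compl closedin_closed_Int)
  moreover have "interior (U - L) = {}"
  proof (rule ccontr)
    assume "interior (U - L) \<noteq> {}"
    then obtain x T where T: "open T" "x \<in> T" "T \<subseteq> U - L"
      by (auto simp: interior_def)
    have J': "jacobian g f y = 0" if "y \<in> U" for y
      using J[OF that] by (subst jacobian_swap) simp
    have "gradient g y = 0" if "y \<in> T" for y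
      using locally_expressible_if_gradient_neq_0[OF U g f J', of y] that T(3)
      by (auto simp: L_def)
    then have "x \<in> L"
      using locally_expressible_if_gradient_eq_0[OF T(1,2) _ g, of f] T(3) by (auto simp: L_def)
    then show False
      using T by blast
  qed
  ultimately show ?thesis
    by (intro exI[of _ "U - L"]) (auto simp: L_def)
qed

section \<open>Relations between two observables and their local inversion\<close>

theorem mainTheorem3:
  fixes U :: "(real \<times> real) set" and H O1 O2 :: "real \<times> real \<Rightarrow> real"
  assumes "open U" and "\<forall>(s, p)\<in>U. 0 < p"
    and "C1_on U H" and "C1_on U O1" and "C1_on U O2"
    and "PST_invariant U H"
    and "invariant_observable U H O1" and "invariant_observable U H O2"
  shows "(\<exists>\<Upsilon> \<in> borel_measurable borel. nontrivial_relation_on U O1 O2 \<Upsilon>)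
    \<and> functionally_dependent_on U O1 O2
    \<and> (\<forall>x\<in>U. partial1 O1 x \<noteq> 0 \<or> partial2 O1 x \<noteq> 0 \<longrightarrow> locally_expressible U O1 O2 x)
    \<and> (\<forall>x\<in>U. partial1 O2 x \<noteq> 0 \<or> partial2 O2 x \<noteq> 0 \<longrightarrow> locally_expressible U O2 O1 x)
    \<and> (\<exists>E \<subseteq> U. closedin (top_of_set U) E \<and> interior E = {} \<and>
         (\<forall>x\<in>U - E. locally_expressible U O1 O2 x \<or> locally_expressible U O2 O1 x))"
proof -
  let ?F = "\<lambda>x. (O1 x, O2 x)"
  have J: "jacobian O1 O2 x = 0" "jacobian O2 O1 x = 0" if "x \<in> U" for x
    using jacobian_observables_eq_0[OF assms(6) _ _ that] assms(7,8) by blast+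
  have neg: "negligible (?F ` U)"
    using negligible_image_jacobian_eq_0[OF assms(4,5) J(1)] .
  have "\<exists>\<Upsilon> \<in> borel_measurable borel. nontrivial_relation_on U O1 O2 \<Upsilon>"
  proof -
    \<comment> \<open>Enlarging the image to a Borel null set makes the indicator of the complement
      a Borel function with zero set exactly \<open>N\<close>.\<close>
    obtain N where N: "N \<in> null_sets lborel" "?F ` U \<subseteq> N"
      using neg unfolding negligible_iff_null_sets null_sets_completion_iff2 by blast
    define \<Upsilon> :: "real \<times> real \<Rightarrow> real" where "\<Upsilon> = indicator (- N)"
    have "\<Upsilon> \<in> borel_measurable borel"
      using N(1) unfolding \<Upsilon>_def by (auto intro!: borel_measurable_indicator)
    moreover have "{z. \<Upsilon> z = 0} = N"
      by (auto simp: \<Upsilon>_def indicator_def)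
    moreover have "negligible N"
      using N(1) by (simp add: negligible_iff_null_sets null_sets_completionI)
    ultimately show ?thesis
      using N(2) by (intro bexI[of _ \<Upsilon>]) (auto simp: nontrivial_relation_on_def)
  qed
  moreover have "functionally_dependent_on U O1 O2"
    unfolding functionally_dependent_on_def
  proof (intro allI impI)
    fix K assume K: "compact K \<and> K \<subseteq> U"
    \<comment> \<open>Compactness makes the image of \<open>K\<close> closed, so it is the exact
      zero set of a C1 function; it is null as part of the image of \<open>U\<close>.\<close>
    have "continuous_on K ?F"
      using assms(4,5)[THEN C1_on_imp_continuous_on] K
      by (auto intro!: continuous_on_Pair intro: continuous_on_subset)
    then have "closed (?F ` K)"
      using K compact_continuous_image compact_imp_closed by blast
    then obtain \<Upsilon> where "C1_on UNIV \<Upsilon>" and \<Upsilon>: "{z. \<Upsilon> z = 0} = ?F ` K"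
      by (rule closed_is_C1_zero_set)
    moreover have "negligible (?F ` K)"
      by (rule negligible_subset[OF neg]) (use K in auto)
    ultimately show "\<exists>\<Upsilon>. C1_on UNIV \<Upsilon> \<and> nontrivial_relation_on K O1 O2 \<Upsilon>"
      unfolding nontrivial_relation_on_def by (intro exI[of _ \<Upsilon>]) auto
  qed
  moreover have "locally_expressible U O1 O2 x"
    if "x \<in> U" "partial1 O1 x \<noteq> 0 \<or> partial2 O1 x \<noteq> 0" for x
    using locally_expressible_if_gradient_neq_0[OF assms(1,4,5) J(1) that(1)] that(2)
    by (auto simp: gradient_def zero_prod_def)
  moreover have "locally_expressible U O2 O1 x"
    if "x \<in> U" "partial1 O2 x \<noteq> 0 \<or> partial2 O2 x \<noteq> 0" for x
    using locally_expressible_if_gradient_neq_0[OF assms(1,5,4) J(2) that(1)] that(2)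
    by (auto simp: gradient_def zero_prod_def)
  ultimately show ?thesis
    using closed_nowhere_dense_exceptional_set[OF assms(1,4,5) J(1)] by (intro conjI ballI impI)
qed

end
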